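(* Let $T>0$ and let $s$ be sufficiently large. Let $u\in C^0((0,T);H^s(\mathbb{R}))$ be a solution on $(0,T)\times\mathbb{R}$ of $$u_{t}-u_{txx}=4uu_{x}+2u_{x}^{2}+2uu_{xx}-6u_{x}u_{xx}-2uu_{xxx}.$$ Assume that $u$ vanishes identically on a (nonempty) open set $\Omega=(T_0,T_1)\times(-\infty,b)\subseteq(0,T)\times\mathbb{R}$, for some $b\in\mathbb{R}$. Then $u\equiv 0$.
   Context: "$s$ sufficiently large" means that there is a real number $s_0$ such that the statement holds for every $s\geq s_0$. $H^s(\mathbb{R})$ is the usual $L^2$-based Sobolev space. Standing assumptions on solutions: $u=u(t,x)$ is a real-valued smooth solution on $(0,T)\times\mathbb{R}$ which, together with its derivatives (in particular its first and second order $x$-derivatives), decays to $0$ as $|x|\to\infty$, fast enough that $G\ast u^2$ is well defined and $u$ satisfies the equivalent non-local form $$u_t+u^2-2uu_x=G\ast u^2 \quad\text{on }(0,T)\times\mathbb{R},$$ where $G(x)=(1-\operatorname{sgn}(x))\,g(x)$, $g(x)=\tfrac12 e^{-|x|}$, and $\ast$ denotes convolution in $x$: $(G\ast u^2)(t,x)=\int_{-\infty}^{+\infty}G(x-y)\,u(t,y)^2\,dy$. *)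

theory Defs
  imports "HOL-Analysis.Analysis"
begin

definition dt :: "(real \<Rightarrow> real \<Rightarrow> real) \<Rightarrow> real \<Rightarrow> real \<Rightarrow> real" where
  "dt u = (\<lambda>t x. deriv (\<lambda>\<tau>. u \<tau> x) t)"

definition dx :: "(real \<Rightarrow> real \<Rightarrow> real) \<Rightarrow> real \<Rightarrow> real \<Rightarrow> real" where
  "dx u = (\<lambda>t x. deriv (\<lambda>y. u t y) x)"

primrec Ck_on :: "nat \<Rightarrow> (real \<times> real) set \<Rightarrow> (real \<Rightarrow> real \<Rightarrow> real) \<Rightarrow> bool" where
  "Ck_on 0 S u \<longleftrightarrow> continuous_on S (\<lambda>(t, x). u t x)"
| "Ck_on (Suc k) S u \<longleftrightarrow>
     continuous_on S (\<lambda>(t, x). u t x) \<and>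
     (\<forall>(t, x)\<in>S. (\<lambda>\<tau>. u \<tau> x) differentiable (at t) \<and> (\<lambda>y. u t y) differentiable (at x)) \<and>
     Ck_on k S (dt u) \<and> Ck_on k S (dx u)"

text \<open>Meant for open \<open>S\<close>: on such sets this is joint smoothness in \<open>(t, x)\<close>.\<close>

definition smooth_on :: "(real \<times> real) set \<Rightarrow> (real \<Rightarrow> real \<Rightarrow> real) \<Rightarrow> bool" where
  "smooth_on S u \<longleftrightarrow> (\<forall>k. Ck_on k S u)"

definition decaying_on :: "real set \<Rightarrow> (real \<Rightarrow> real \<Rightarrow> real) \<Rightarrow> bool" where
  "decaying_on I u \<longleftrightarrow>
     (\<forall>t\<in>I. \<forall>i j. ((\<lambda>x. (dt ^^ i) ((dx ^^ j) u) t x) \<longlongrightarrow> 0) at_infinity)"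

definition L2 :: "(real \<Rightarrow> complex) set" where
  "L2 = {f \<in> borel_measurable lborel. integrable lborel (\<lambda>x. (cmod (f x))\<^sup>2)}"

text \<open>The Fourier--Plancherel transform of \<open>f \<in> L\<^sup>2\<close> is the limit in \<open>L\<^sup>2\<close>, as \<open>R \<rightarrow> \<infinity>\<close>, of
  the Fourier integrals of \<open>f\<close> truncated to \<open>[-R, R]\<close>; it is determined up to a null set.
  The distance is a nonnegative extended integral, so that no convention for
  non-integrable functions intervenes.\<close>

definition truncated_fourier :: "real \<Rightarrow> (real \<Rightarrow> complex) \<Rightarrow> real \<Rightarrow> complex" where
  "truncated_fourier R f \<xi> =
     (1 / sqrt (2 * pi)) *\<^sub>R (LINT x:{-R..R}|lborel. f x * exp (- \<i> * complex_of_real (x * \<xi>)))"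

definition is_fourier_L2 :: "(real \<Rightarrow> complex) \<Rightarrow> (real \<Rightarrow> complex) \<Rightarrow> bool" where
  "is_fourier_L2 f F \<longleftrightarrow> f \<in> L2 \<and> F \<in> L2 \<and>
     ((\<lambda>R. \<integral>\<^sup>+ \<xi>. ennreal ((cmod (truncated_fourier R f \<xi> - F \<xi>))\<^sup>2) \<partial>lborel) \<longlongrightarrow> 0) at_top"

definition fourier_L2 :: "(real \<Rightarrow> complex) \<Rightarrow> real \<Rightarrow> complex" where
  "fourier_L2 f = (SOME F. is_fourier_L2 f F)"

text \<open>\<open>H\<^sup>s\<close> for \<open>s \<ge> 0\<close>, where it is a subspace of \<open>L\<^sup>2\<close>.  For \<open>s < 0\<close> the set below is only
  \<open>L\<^sup>2\<close>, not the full space of distributions \<open>H\<^sup>s\<close>.\<close>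

definition Hs :: "real \<Rightarrow> (real \<Rightarrow> complex) set" where
  "Hs s = {f. \<exists>F. is_fourier_L2 f F \<and>
                  integrable lborel (\<lambda>\<xi>. (1 + \<xi>\<^sup>2) powr s * (cmod (F \<xi>))\<^sup>2)}"

definition Hs_norm :: "real \<Rightarrow> (real \<Rightarrow> complex) \<Rightarrow> real" where
  "Hs_norm s f = sqrt (LINT \<xi>|lborel. (1 + \<xi>\<^sup>2) powr s * (cmod (fourier_L2 f \<xi>))\<^sup>2)"

definition C0_Hs :: "real set \<Rightarrow> real \<Rightarrow> (real \<Rightarrow> real \<Rightarrow> real) \<Rightarrow> bool" where
  "C0_Hs I s u \<longleftrightarrow>
     (\<forall>t\<in>I. (\<lambda>x. complex_of_real (u t x)) \<in> Hs s) \<and>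
     (\<forall>t\<in>I. ((\<lambda>\<tau>. Hs_norm s (\<lambda>x. complex_of_real (u \<tau> x - u t x))) \<longlongrightarrow> 0) (at t within I))"

definition g :: "real \<Rightarrow> real" where
  "g x = exp (- \<bar>x\<bar>) / 2"

definition G :: "real \<Rightarrow> real" where
  "G x = (1 - sgn x) * g x"

definition solves_pde :: "real \<Rightarrow> (real \<Rightarrow> real \<Rightarrow> real) \<Rightarrow> bool" where
  "solves_pde T u \<longleftrightarrow>
     (\<forall>t\<in>{0<..<T}. \<forall>x.
        dt u t x - dx (dx (dt u)) t x =
          4 * u t x * dx u t x + 2 * (dx u t x)\<^sup>2 + 2 * u t x * dx (dx u) t x
          - 6 * dx u t x * dx (dx u) t x - 2 * u t x * dx (dx (dx u)) t x)"

text \<open>Integrability of the integrand is required separately: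
  the integral of a non-integrable function is \<open>0\<close> by convention.\<close>

definition solves_nonlocal :: "real \<Rightarrow> (real \<Rightarrow> real \<Rightarrow> real) \<Rightarrow> bool" where
  "solves_nonlocal T u \<longleftrightarrow>
     (\<forall>t\<in>{0<..<T}. \<forall>x.
        integrable lborel (\<lambda>y. G (x - y) * (u t y)\<^sup>2) \<and>
        dt u t x + (u t x)\<^sup>2 - 2 * u t x * dx u t x = (LINT y|lborel. G (x - y) * (u t y)\<^sup>2))"

end

theory Submission
  imports Defs "HOL-Probability.Probability"
begin

text \<open>The kernel \<open>G\<close> lives on the negative half-line, so that
  \<open>(G \<ast> u\<^sup>2)(t, x)\<close> is the integral of \<open>exp (x - y) (u t y)\<^sup>2\<close> over \<open>y > x\<close>: the equation at a
  point sees \<open>u\<^sup>2\<close>, with a positive weight, on the whole half-line to the right of that point. At a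
  point where \<open>u\<close> vanishes in a neighbourhood the left side of the nonlocal equation is zero, so
  \<open>u t\<close> vanishes to the right of it. On the given open set this makes \<open>u t\<close> vanish on the
  whole line for every \<open>t\<close> between \<open>T\<^sub>0\<close> and \<open>T\<^sub>1\<close> (\<open>vanishing_time_slice\<close>).

  What remains is uniqueness, forward and backward in time, for the zero solution. The set of times
  at which the solution vanishes identically is closed in \<open>(0, T)\<close> by continuity; it is
  enough to show that it is also open, and then connectedness concludes. Let \<open>u\<close> vanish at time
  \<open>t\<^sub>0\<close> and suppose \<open>\<bar>u\<bar> \<le> K\<close> for all times within \<open>\<delta>\<close> of \<open>t\<^sub>0\<close>. As \<open>G\<close> has total mass one,
  \<open>0 \<le> G \<ast> u\<^sup>2 \<le> K\<^sup>2\<close>, hence \<open>\<bar>u\<^sub>t - 2 u u\<^sub>x\<bar> \<le> K\<^sup>2\<close>. This is a transport equation with bounded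
  speed and bounded source, and a maximum principle with a slowly growing barrier
  (\<open>transport_upper_bound\<close>) gives \<open>\<bar>u\<bar> \<le> K\<^sup>2 \<delta>\<close>, which is at most \<open>K / 2\<close> when \<open>\<delta>\<close> is small.
  Iterating, \<open>u\<close> vanishes near \<open>t\<^sub>0\<close> (\<open>local_uniqueness_at_zero\<close>).

  The argument starts from some bound on \<open>\<bar>u\<bar>\<close> that is uniform in \<open>x\<close> and in \<open>t\<close> near \<open>t\<^sub>0\<close>. This is
  where continuity of the solution with values in \<open>H\<^sup>s\<close> enters: the \<open>H\<^sup>s\<close> norm tends to zero as
  \<open>t \<rightarrow> t\<^sub>0\<close>, and for \<open>s \<ge> 1\<close> it controls the \<open>L\<^sup>1\<close> norm of the Fourier transform, hence the sup norm
  (\<open>sup_bound_of_Hs_norm\<close>). Pointwise Fourier inversion is replaced by testing the \<open>L\<^sup>2\<close> transform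
  against modulated Gaussians, whose transforms are approximate identities.\<close>

section \<open>Fourier transforms in L2 and the Sobolev sup bound\<close>

lemma truncated_fourier_measurable [measurable]:
  assumes [measurable]: "f \<in> borel_measurable borel"
  shows "truncated_fourier R f \<in> borel_measurable borel"
  unfolding truncated_fourier_def set_lebesgue_integral_def by measurable

text \<open>Both candidates are \<open>L\<^sup>2\<close> limits of the same truncated transforms. The distance is handled as an
  extended nonnegative integral, squared, so the triangle inequality takes the form
  \<open>(a + b)\<^sup>2 \<le> 2 a\<^sup>2 + 2 b\<^sup>2\<close>.\<close>

lemma is_fourier_L2_unique:
  assumes F: "is_fourier_L2 f F" and F': "is_fourier_L2 f F'"
  shows "AE \<xi> in lborel. F \<xi> = F' \<xi>"
proof -
  have [measurable]: "f \<in> borel_measurable borel" "F \<in> borel_measurable borel" "F' \<in> borel_measurable borel"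
    using F F' by (auto simp: is_fourier_L2_def L2_def)
  let ?T = "\<lambda>R. truncated_fourier R f"
  let ?D = "\<lambda>F R. \<integral>\<^sup>+ \<xi>. ennreal ((cmod (?T R \<xi> - F \<xi>))\<^sup>2) \<partial>lborel"
  let ?E = "\<integral>\<^sup>+ \<xi>. ennreal ((cmod (F \<xi> - F' \<xi>))\<^sup>2) \<partial>lborel"
  have le: "?E \<le> 2 * ?D F R + 2 * ?D F' R" for R
  proof -
    have "(cmod (F \<xi> - F' \<xi>))\<^sup>2 \<le> 2 * (cmod (?T R \<xi> - F \<xi>))\<^sup>2 + 2 * (cmod (?T R \<xi> - F' \<xi>))\<^sup>2" for \<xi>
    proof -
      define a b where "a = cmod (?T R \<xi> - F \<xi>)" and "b = cmod (?T R \<xi> - F' \<xi>)"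
      have "cmod (F \<xi> - F' \<xi>) \<le> a + b"
        using norm_triangle_ineq4[of "?T R \<xi> - F' \<xi>" "?T R \<xi> - F \<xi>"] by (simp add: a_def b_def)
      then have "(cmod (F \<xi> - F' \<xi>))\<^sup>2 \<le> (a + b)\<^sup>2" by (intro power_mono) auto
      also have "\<dots> \<le> 2 * a\<^sup>2 + 2 * b\<^sup>2"
        using zero_le_power2[of "a - b"] by (simp add: power2_eq_square algebra_simps)
      finally show ?thesis by (simp add: a_def b_def)
    qed
    then have "?E \<le> (\<integral>\<^sup>+ \<xi>. 2 * ennreal ((cmod (?T R \<xi> - F \<xi>))\<^sup>2) + 2 * ennreal ((cmod (?T R \<xi> - F' \<xi>))\<^sup>2) \<partial>lborel)"
      by (intro nn_integral_mono)
        (simp add: ennreal_mult'[symmetric] ennreal_plus[symmetric] del: ennreal_plus flip: ennreal_numeral)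
    also have "\<dots> = 2 * ?D F R + 2 * ?D F' R"
      by (simp add: nn_integral_add nn_integral_cmult)
    finally show ?thesis .
  qed
  have "((\<lambda>R. 2 * ?D F R + 2 * ?D F' R) \<longlongrightarrow> 2 * 0 + 2 * 0) at_top"
    using F F' by (intro tendsto_add ennreal_tendsto_cmult) (auto simp: is_fourier_L2_def)
  then have "?E \<le> 2 * 0 + 2 * 0"
    by (rule tendsto_lowerbound) (auto intro: always_eventually le)
  then have "?E = 0" by simp
  then have "AE \<xi> in lborel. ennreal ((cmod (F \<xi> - F' \<xi>))\<^sup>2) = 0"
    by (subst (asm) nn_integral_0_iff_AE) auto
  then show ?thesis by eventually_elim simp
qed

text \<open>The Gaussian is its own Fourier transform; this is the characteristic function of the standard
  normal distribution, rescaled.\<close>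

lemma integral_gaussian_iexp:
  fixes a \<epsilon> :: real
  assumes \<epsilon>: "\<epsilon> > 0"
  shows "(CLINT \<xi>|lborel. std_normal_density (\<epsilon> * \<xi>) * iexp (a * \<xi>))
    = complex_of_real (sqrt (2 * pi) * (std_normal_density (a / \<epsilon>) / \<epsilon>))"
proof -
  have "(CLINT z|lborel. std_normal_density z * iexp (t * z)) = exp (- (t^2) / 2)" for t :: real
  proof -
    have "complex_of_real (exp (- (t^2) / 2)) = (CLINT z|std_normal_distribution. iexp (t * z))"
      using char_std_normal_distribution by (metis char_def)
    also have "\<dots> = (CLINT z|lborel. std_normal_density z *\<^sub>R iexp (t * z))"
      by (subst integral_density) (auto simp: normal_density_nonneg)
    finally show ?thesis by (simp add: scaleR_conv_of_real)
  qed
  from this[of "a / \<epsilon>"]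
  have "(CLINT z|lborel. std_normal_density z * iexp (a / \<epsilon> * z)) = exp (- ((a / \<epsilon>)^2) / 2)" .
  moreover have "(CLINT z|lborel. std_normal_density z * iexp (a / \<epsilon> * z))
    = \<epsilon> *\<^sub>R (CLINT \<xi>|lborel. std_normal_density (\<epsilon> * \<xi>) * iexp (a * \<xi>))"
    using \<epsilon> lborel_integral_real_affine[of \<epsilon> "\<lambda>z. std_normal_density z * iexp (a / \<epsilon> * z)" 0]
    by (simp add: mult.assoc)
  ultimately show ?thesis using \<epsilon>
    by (simp add: std_normal_density_def scaleR_conv_of_real field_simps)
qed

lemma integrable_gaussian_scaled: "\<epsilon> > 0 \<Longrightarrow> integrable lborel (\<lambda>\<xi>. std_normal_density (\<epsilon> * \<xi>))"
  and integral_gaussian_scaled: "\<epsilon> > 0 \<Longrightarrow> (LINT \<xi>|lborel. std_normal_density (\<epsilon> * \<xi>)) = 1 / \<epsilon>"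
proof -
  assume \<epsilon>: "\<epsilon> > 0"
  have i: "integrable lborel std_normal_density" by (simp add: integrable_normal_density)
  show "integrable lborel (\<lambda>\<xi>. std_normal_density (\<epsilon> * \<xi>))"
    using lborel_integrable_real_affine[OF i, of \<epsilon> 0] \<epsilon> by simp
  show "(LINT \<xi>|lborel. std_normal_density (\<epsilon> * \<xi>)) = 1 / \<epsilon>"
    using lborel_integral_real_affine[of \<epsilon> std_normal_density 0] \<epsilon>
    by (simp add: integral_normal_density field_simps)
qed

lemma std_normal_density_le: "std_normal_density z \<le> 1 / sqrt (2 * pi)"
  by (simp add: std_normal_density_def divide_right_mono)

text \<open>Fubini moves the transform from \<open>f\<close> onto the test function. The modulation by \<open>x\<close> turns into a
  translation, so that the right side is a truncated mollification of \<open>f\<close> around \<open>x\<close> at scale \<open>\<epsilon>\<close>.\<close>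

lemma truncated_fourier_gaussian:
  fixes f :: "real \<Rightarrow> complex"
  assumes [measurable]: "f \<in> borel_measurable borel" and bdd: "\<And>y. cmod (f y) \<le> B" and \<epsilon>: "\<epsilon> > 0"
  shows "(CLINT \<xi>|lborel. truncated_fourier R f \<xi> * (std_normal_density (\<epsilon> * \<xi>) * iexp (x * \<xi>)))
     = (CLINT y|lborel. indicator {-R..R} y * f y * (std_normal_density ((x - y) / \<epsilon>) / \<epsilon>))"
proof -
  define H where "H = (\<lambda>y \<xi>. indicator {-R..R} y * f y * (std_normal_density (\<epsilon> * \<xi>) * iexp ((x - y) * \<xi>)))"
  have [measurable]: "(\<lambda>(y, \<xi>). H y \<xi>) \<in> borel_measurable (lborel \<Otimes>\<^sub>M lborel)"
    unfolding H_def by measurable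
  have nH: "cmod (H y \<xi>) = (indicator {-R..R} y * cmod (f y)) * std_normal_density (\<epsilon> * \<xi>)" for y \<xi>
    by (simp add: H_def norm_mult normal_density_nonneg split: split_indicator)
  have fi: "integrable lborel (\<lambda>y. indicator {-R..R} y * cmod (f y))"
  proof (rule Bochner_Integration.integrable_bound)
    show "integrable lborel (\<lambda>y. indicator {-R..R} y * B)"
      by (intro integrable_mult_left)
        (use emeasure_bounded_finite[of "{-R..R}"] in \<open>simp add: integrable_indicator_iff\<close>)
  qed (use bdd order_trans[OF bdd abs_ge_self] in \<open>auto split: split_indicator\<close>)
  have int: "integrable (lborel \<Otimes>\<^sub>M lborel) (\<lambda>(y, \<xi>). H y \<xi>)"
  proof (rule lborel_pair.Fubini_integrable)
    show "integrable lborel (\<lambda>y. LINT \<xi>|lborel. norm (case (y, \<xi>) of (y, \<xi>) \<Rightarrow> H y \<xi>))"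
      using fi by (simp add: nH)
    show "AE y in lborel. integrable lborel (\<lambda>\<xi>. case (y, \<xi>) of (y, \<xi>) \<Rightarrow> H y \<xi>)"
    proof (rule AE_I2)
      fix y :: real
      have "integrable lborel (\<lambda>\<xi>. cmod (H y \<xi>))"
        unfolding nH by (intro integrable_mult_right integrable_gaussian_scaled \<epsilon>)
      moreover have "H y \<in> borel_measurable lborel" unfolding H_def by measurable
      ultimately have "integrable lborel (H y)" by (rule integrable_norm_cancel)
      then show "integrable lborel (\<lambda>\<xi>. case (y, \<xi>) of (y, \<xi>) \<Rightarrow> H y \<xi>)"
        by (simp only: prod.case)
    qed
  qed measurable
  have "(CLINT \<xi>|lborel. truncated_fourier R f \<xi> * (std_normal_density (\<epsilon> * \<xi>) * iexp (x * \<xi>)))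
     = (CLINT \<xi>|lborel. (1 / sqrt (2 * pi)) *\<^sub>R (CLINT y|lborel. H y \<xi>))"
  proof (rule Bochner_Integration.integral_cong[OF refl])
    fix \<xi> :: real
    let ?\<psi> = "complex_of_real (std_normal_density (\<epsilon> * \<xi>)) * iexp (x * \<xi>)"
    let ?h = "\<lambda>y. indicator {-R..R} y *\<^sub>R (f y * exp (- \<i> * complex_of_real (y * \<xi>)))"
    have "(CLINT y|lborel. H y \<xi>) = (CLINT y|lborel. ?h y * ?\<psi>)"
      by (intro Bochner_Integration.integral_cong refl)
         (simp add: H_def scaleR_conv_of_real exp_diff exp_minus field_simps split: split_indicator)
    also have "\<dots> = (CLINT y|lborel. ?h y) * ?\<psi>"
      by (rule integral_mult_left_zero)
    finally show "truncated_fourier R f \<xi> * ?\<psi> = (1 / sqrt (2 * pi)) *\<^sub>R (CLINT y|lborel. H y \<xi>)"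
      by (simp only: truncated_fourier_def set_lebesgue_integral_def mult_scaleR_left)
  qed
  also have "\<dots> = (1 / sqrt (2 * pi)) *\<^sub>R (CLINT y|lborel. CLINT \<xi>|lborel. H y \<xi>)"
    using lborel_pair.Fubini_integral[OF int] by simp
  also have "\<dots> = (CLINT y|lborel. (1 / sqrt (2 * pi)) *\<^sub>R (CLINT \<xi>|lborel. H y \<xi>))"
    by simp
  also have "\<dots> = (CLINT y|lborel. indicator {-R..R} y * f y * (std_normal_density ((x - y) / \<epsilon>) / \<epsilon>))"
    unfolding H_def integral_mult_right_zero integral_gaussian_iexp[OF \<epsilon>]
    by (simp add: scaleR_conv_of_real mult.assoc)
  finally show ?thesis .
qed

text \<open>A substitute for Fourier inversion. The mollification \<open>m \<epsilon>\<close> of \<open>f\<close> at \<open>x\<close> is the limit, as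
  \<open>R \<rightarrow> \<infinity>\<close>, of the pairing \<open>I R\<close> of the truncated transform with a modulated Gaussian \<open>\<psi>\<close>. Since
  \<open>\<bar>\<psi>\<bar> \<le> 1 / sqrt (2 pi)\<close> and the truncated transforms converge to \<open>F\<close> in \<open>L\<^sup>2\<close>, the limit is bounded by
  the \<open>L\<^sup>1\<close> norm of \<open>F\<close>, with a bound that does not depend on \<open>\<epsilon>\<close>; finally \<open>\<epsilon> \<rightarrow> 0\<close>.\<close>

lemma continuous_bounded_le_L1_fourier:
  fixes f F :: "real \<Rightarrow> complex"
  assumes fourier: "is_fourier_L2 f F" and F1: "integrable lborel F"
    and cont: "continuous_on UNIV f" and bdd: "\<And>y. cmod (f y) \<le> B"
  shows "cmod (f x) \<le> (LINT \<xi>|lborel. cmod (F \<xi>)) / sqrt (2 * pi)"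
proof -
  have [measurable]: "f \<in> borel_measurable borel" "F \<in> borel_measurable borel"
    using fourier by (auto simp: is_fourier_L2_def L2_def)
  define A where "A = (LINT \<xi>|lborel. cmod (F \<xi>)) / sqrt (2 * pi)"
  have A0: "A \<ge> 0" by (simp add: A_def)
  have B0: "B \<ge> 0" using bdd[of 0] norm_ge_zero order_trans by blast
  let ?T = "\<lambda>R. truncated_fourier R f"
  let ?D = "\<lambda>R. \<integral>\<^sup>+ \<xi>. ennreal ((cmod (?T R \<xi> - F \<xi>))\<^sup>2) \<partial>lborel"
  let ?k = "\<lambda>\<epsilon> y. complex_of_real (std_normal_density ((x - y) / \<epsilon>) / \<epsilon>)"
  define m where "m = (\<lambda>\<epsilon>. CLINT y|lborel. f y * ?k \<epsilon> y)"
  have kernel: "integrable lborel (\<lambda>y. std_normal_density ((x - y) / \<epsilon>) / \<epsilon>)" if \<epsilon>: "\<epsilon> > 0" for \<epsilon>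
    using lborel_integrable_real_affine[OF integrable_gaussian_scaled[of "1/\<epsilon>"], of "-1" x] \<epsilon>
    by simp
  have m_le: "cmod (m \<epsilon>) \<le> A" if \<epsilon>: "\<epsilon> > 0" for \<epsilon>
  proof (rule field_le_epsilon)
    fix e :: real assume e: "e > 0"
    define \<eta> where "\<eta> = e * \<epsilon>"
    have \<eta>: "\<eta> > 0" using e \<epsilon> by (simp add: \<eta>_def)
    define \<psi> where "\<psi> = (\<lambda>\<xi>. complex_of_real (std_normal_density (\<epsilon> * \<xi>)) * iexp (x * \<xi>))"
    have [measurable]: "\<psi> \<in> borel_measurable borel" unfolding \<psi>_def by measurable
    define I where "I = (\<lambda>R. CLINT \<xi>|lborel. ?T R \<xi> * \<psi> \<xi>)"
    have n\<psi>: "cmod (\<psi> \<xi>) = std_normal_density (\<epsilon> * \<xi>)" for \<xi>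
      by (simp add: \<psi>_def norm_mult normal_density_nonneg)
    \<comment> \<open>The product is split as \<open>a b \<le> a\<^sup>2 / \<eta> + \<eta> b\<close>, valid since \<open>b \<le> 1\<close>. The integral of \<open>a\<^sup>2\<close> tends
      to \<open>0\<close> with \<open>R \<rightarrow> \<infinity>\<close>, and \<open>\<eta>\<close> is chosen so that the integral of \<open>\<eta> b\<close> is \<open>e\<close>.\<close>
    have young: "cmod (?T R \<xi> * \<psi> \<xi>) \<le> cmod (F \<xi>) / sqrt (2 * pi)
        + (1 / \<eta> * (cmod (?T R \<xi> - F \<xi>))\<^sup>2 + \<eta> * std_normal_density (\<epsilon> * \<xi>))" for R \<xi>
    proof -
      define a b where "a = cmod (?T R \<xi> - F \<xi>)" and "b = std_normal_density (\<epsilon> * \<xi>)"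
      have b: "0 \<le> b" "b \<le> 1 / sqrt (2 * pi)"
        unfolding b_def by (auto simp: normal_density_nonneg intro: std_normal_density_le)
      have "1 \<le> sqrt (2 * pi)" using pi_gt3 by (simp add: real_le_rsqrt)
      then have b1: "b \<le> 1" using b(2) by (smt (verit) divide_le_eq_1)
      have "cmod (?T R \<xi>) \<le> cmod (F \<xi>) + a"
        using norm_triangle_ineq[of "F \<xi>" "?T R \<xi> - F \<xi>"] by (simp add: a_def)
      then have "cmod (?T R \<xi> * \<psi> \<xi>) \<le> (cmod (F \<xi>) + a) * b"
        unfolding norm_mult n\<psi> b_def[symmetric] using b by (intro mult_right_mono) auto
      also have "\<dots> = cmod (F \<xi>) * b + a * b" by (simp add: algebra_simps)
      also have "cmod (F \<xi>) * b \<le> cmod (F \<xi>) / sqrt (2 * pi)"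
        using mult_left_mono[OF b(2), of "cmod (F \<xi>)"] by simp
      also have "a * b \<le> 1 / \<eta> * a\<^sup>2 + \<eta> * b"
      proof -
        have "0 \<le> (a - \<eta> * b)\<^sup>2 / \<eta>" using \<eta> by simp
        also have "\<dots> = 1 / \<eta> * a\<^sup>2 - 2 * (a * b) + \<eta> * b\<^sup>2"
          using \<eta> by (simp add: field_simps power2_eq_square)
        finally have "2 * (a * b) \<le> 1 / \<eta> * a\<^sup>2 + \<eta> * b\<^sup>2" by simp
        moreover have "\<eta> * b\<^sup>2 \<le> \<eta> * b"
          using \<eta> b b1 by (simp add: power2_eq_square mult_left_le)
        moreover have "0 \<le> a * b" using b by (simp add: a_def)
        ultimately show ?thesis by linarith
      qed
      finally show ?thesis by (simp add: a_def b_def)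
    qed
    have I_le: "ennreal (cmod (I R)) \<le> ennreal A + (ennreal (1 / \<eta>) * ?D R + ennreal e)" for R
    proof -
      have "ennreal (cmod (I R)) \<le> (\<integral>\<^sup>+ \<xi>. ennreal (cmod (?T R \<xi> * \<psi> \<xi>)) \<partial>lborel)"
      proof (cases "integrable lborel (\<lambda>\<xi>. ?T R \<xi> * \<psi> \<xi>)")
        case True
        then show ?thesis unfolding I_def by (rule integral_norm_bound_ennreal)
      qed (simp add: I_def not_integrable_integral_eq)
      also have "\<dots> \<le> (\<integral>\<^sup>+ \<xi>. ennreal (cmod (F \<xi>) / sqrt (2 * pi))
          + (ennreal (1 / \<eta>) * ennreal ((cmod (?T R \<xi> - F \<xi>))\<^sup>2) + ennreal (\<eta> * std_normal_density (\<epsilon> * \<xi>))) \<partial>lborel)"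
      proof (rule nn_integral_mono)
        fix \<xi>
        have "ennreal (cmod (?T R \<xi> * \<psi> \<xi>)) \<le> ennreal (cmod (F \<xi>) / sqrt (2 * pi)
          + (1 / \<eta> * (cmod (?T R \<xi> - F \<xi>))\<^sup>2 + \<eta> * std_normal_density (\<epsilon> * \<xi>)))"
          by (rule ennreal_leI[OF young])
        also have "\<dots> = ennreal (cmod (F \<xi>) / sqrt (2 * pi))
          + (ennreal (1 / \<eta>) * ennreal ((cmod (?T R \<xi> - F \<xi>))\<^sup>2) + ennreal (\<eta> * std_normal_density (\<epsilon> * \<xi>)))"
          using \<eta> by (simp add: ennreal_mult'[symmetric] normal_density_nonneg)
        finally show "ennreal (cmod (?T R \<xi> * \<psi> \<xi>)) \<le> \<dots>" .
      qed
      also have "\<dots> = (\<integral>\<^sup>+ \<xi>. ennreal (cmod (F \<xi>) / sqrt (2 * pi)) \<partial>lborel)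
          + (ennreal (1 / \<eta>) * ?D R + (\<integral>\<^sup>+ \<xi>. ennreal (\<eta> * std_normal_density (\<epsilon> * \<xi>)) \<partial>lborel))"
        by (simp add: nn_integral_add nn_integral_cmult)
      also have "(\<integral>\<^sup>+ \<xi>. ennreal (cmod (F \<xi>) / sqrt (2 * pi)) \<partial>lborel) = ennreal A"
        unfolding A_def using F1 by (subst nn_integral_eq_integral) auto
      also have "(\<integral>\<^sup>+ \<xi>. ennreal (\<eta> * std_normal_density (\<epsilon> * \<xi>)) \<partial>lborel) = ennreal e"
        using \<eta> \<epsilon> integrable_gaussian_scaled[OF \<epsilon>] integral_gaussian_scaled[OF \<epsilon>]
        by (subst nn_integral_eq_integral) (auto simp: normal_density_nonneg \<eta>_def)
      finally show ?thesis .
    qed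
    have "(I \<longlongrightarrow> m \<epsilon>) at_top"
    proof -
      have "I = (\<lambda>R. CLINT y|lborel. indicator {-R..R} y * f y * ?k \<epsilon> y)"
        unfolding I_def \<psi>_def
        using truncated_fourier_gaussian[OF _ bdd \<epsilon>, where x=x] by (intro ext) simp
      moreover have "((\<lambda>R. CLINT y|lborel. indicator {-R..R} y * f y * ?k \<epsilon> y) \<longlongrightarrow> m \<epsilon>) at_top"
        unfolding m_def
      proof (rule integral_dominated_convergence_at_top)
        show "integrable lborel (\<lambda>y. B * (std_normal_density ((x - y) / \<epsilon>) / \<epsilon>))"
          by (intro integrable_mult_right kernel \<epsilon>)
        show "\<forall>\<^sub>F R in at_top. AE y in lborel. cmod (indicator {-R..R} y * f y * ?k \<epsilon> y) \<le> B * (std_normal_density ((x - y) / \<epsilon>) / \<epsilon>)"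
          using \<epsilon> bdd B0 by (intro always_eventually allI AE_I2)
            (auto simp: norm_mult norm_divide normal_density_nonneg intro!: divide_right_mono mult_right_mono split: split_indicator)
        show "AE y in lborel. ((\<lambda>R. indicator {-R..R} y * f y * ?k \<epsilon> y) \<longlongrightarrow> f y * ?k \<epsilon> y) at_top"
        proof (intro AE_I2 tendsto_eventually)
          fix y :: real
          show "\<forall>\<^sub>F R in at_top. indicator {-R..R} y * f y * ?k \<epsilon> y = f y * ?k \<epsilon> y"
            using eventually_ge_at_top[of "\<bar>y\<bar>"] by eventually_elim (auto simp: abs_le_iff)
        qed
      qed measurable
      ultimately show ?thesis by simp
    qed
    then have L: "((\<lambda>R. ennreal (cmod (I R))) \<longlongrightarrow> ennreal (cmod (m \<epsilon>))) at_top"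
      by (intro tendsto_ennrealI tendsto_norm)
    have "((\<lambda>R. ennreal A + (ennreal (1 / \<eta>) * ?D R + ennreal e)) \<longlongrightarrow> ennreal A + (ennreal (1 / \<eta>) * 0 + ennreal e)) at_top"
      using fourier by (intro tendsto_add tendsto_const ennreal_tendsto_cmult) (auto simp: is_fourier_L2_def)
    from tendsto_le[OF _ this L] have "ennreal (cmod (m \<epsilon>)) \<le> ennreal A + (ennreal (1 / \<eta>) * 0 + ennreal e)"
      using I_le by (auto intro: always_eventually)
    also have "\<dots> = ennreal (A + e)" using A0 e by simp
    finally show "cmod (m \<epsilon>) \<le> A + e" using A0 e by (subst (asm) ennreal_le_iff) auto
  qed
  have "(\<lambda>n. m (1 / real (Suc n))) \<longlonglongrightarrow> f x"
  proof -
    have m_eq: "m \<epsilon> = (CLINT z|lborel. f (x + \<epsilon> * z) * complex_of_real (std_normal_density z))" if \<epsilon>: "\<epsilon> > 0" for \<epsilon>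
    proof -
      have "std_normal_density (-z) = std_normal_density z" for z by (simp add: std_normal_density_def)
      then show ?thesis
      unfolding m_def using \<epsilon>
        lborel_integral_real_affine[of \<epsilon> "\<lambda>y. f y * ?k \<epsilon> y" x]
      by (simp add: scaleR_conv_of_real)
    qed
    have "(\<lambda>n. CLINT z|lborel. f (x + 1 / real (Suc n) * z) * complex_of_real (std_normal_density z))
        \<longlonglongrightarrow> (CLINT z|lborel. f x * complex_of_real (std_normal_density z))"
    proof (rule integral_dominated_convergence)
      show "integrable lborel (\<lambda>z. B * std_normal_density z)" by (simp add: integrable_normal_density)
      show "AE z in lborel. cmod (f (x + 1 / real (Suc n) * z) * complex_of_real (std_normal_density z)) \<le> B * std_normal_density z" for n
        using bdd by (intro AE_I2) (auto simp: norm_mult normal_density_nonneg intro!: mult_right_mono)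
      show "AE z in lborel. (\<lambda>n. f (x + 1 / real (Suc n) * z) * complex_of_real (std_normal_density z)) \<longlonglongrightarrow> f x * complex_of_real (std_normal_density z)"
      proof (rule AE_I2)
        fix z :: real
        have "(\<lambda>n. x + 1 / real (Suc n) * z) \<longlonglongrightarrow> x + 0 * z"
          by (intro tendsto_intros LIMSEQ_Suc[OF lim_1_over_n])
        then have "(\<lambda>n. f (x + 1 / real (Suc n) * z)) \<longlonglongrightarrow> f x"
          using continuous_on_tendsto_compose[OF cont, of "\<lambda>n. x + 1 / real (Suc n) * z" x] by simp
        then show "(\<lambda>n. f (x + 1 / real (Suc n) * z) * complex_of_real (std_normal_density z)) \<longlonglongrightarrow> f x * complex_of_real (std_normal_density z)"
          by (intro tendsto_intros)
      qed
    qed measurable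
    moreover have "(CLINT z|lborel. f x * complex_of_real (std_normal_density z)) = f x"
      by (simp add: integral_normal_density)
    ultimately show ?thesis by (simp add: m_eq del: of_nat_Suc)
  qed
  then have "(\<lambda>n. cmod (m (1 / real (Suc n)))) \<longlonglongrightarrow> cmod (f x)" by (rule tendsto_norm)
  then have "cmod (f x) \<le> A" by (rule LIMSEQ_le_const2) (intro exI[of _ 0] allI impI m_le, simp)
  then show ?thesis by (simp add: A_def)
qed

text \<open>The embedding of \<open>H\<^sup>s\<close> into bounded functions for \<open>s \<ge> 1\<close>, on the unit ball only. Instead of the
  Cauchy--Schwarz inequality, the \<open>L\<^sup>1\<close> norm of the transform is estimated by
  \<open>2 a \<le> 1 / p + p a\<^sup>2\<close> with \<open>p = 1 + \<xi>\<^sup>2\<close>; the integral of \<open>1 / p\<close> is \<open>pi\<close>.\<close>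

lemma sup_bound_of_Hs_norm:
  fixes f :: "real \<Rightarrow> complex"
  assumes s: "1 \<le> s" and Hs: "f \<in> Hs s" and norm: "Hs_norm s f \<le> 1"
    and cont: "continuous_on UNIV f" and bdd: "\<And>y. cmod (f y) \<le> B"
  shows "cmod (f x) \<le> (pi + 1) / (2 * sqrt (2 * pi))"
proof -
  obtain F0 where F0: "is_fourier_L2 f F0"
    and w0: "integrable lborel (\<lambda>\<xi>. (1 + \<xi>\<^sup>2) powr s * (cmod (F0 \<xi>))\<^sup>2)"
    using Hs unfolding Hs_def by auto
  define F where "F = fourier_L2 f"
  have F: "is_fourier_L2 f F"
    unfolding F_def fourier_L2_def using F0 by (rule someI[where P="is_fourier_L2 f"])
  have [measurable]: "F \<in> borel_measurable borel" "F0 \<in> borel_measurable borel"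
    using F F0 by (auto simp: is_fourier_L2_def L2_def)
  let ?w = "\<lambda>\<xi>. (1 + \<xi>\<^sup>2) powr s * (cmod (F \<xi>))\<^sup>2"
  \<comment> \<open>The integral in the norm is that of the chosen transform; it has to be finite for the norm
    to carry information, because a divergent integral would count as \<open>0\<close>.\<close>
  have "AE \<xi> in lborel. (1 + \<xi>\<^sup>2) powr s * (cmod (F0 \<xi>))\<^sup>2 = ?w \<xi>"
    using is_fourier_L2_unique[OF F0 F] by eventually_elim simp
  then have w: "integrable lborel ?w"
    using w0 by (subst (asm) integrable_cong_AE) auto
  have "(LINT \<xi>|lborel. ?w \<xi>) \<ge> 0" by (intro Bochner_Integration.integral_nonneg) simp
  then have w1: "(LINT \<xi>|lborel. ?w \<xi>) \<le> 1"
    using norm by (simp add: Hs_norm_def F_def[symmetric])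
  have c: "integrable lborel (\<lambda>\<xi>::real. inverse (1 + \<xi>\<^sup>2))" and cpi: "(LINT \<xi>|lborel. inverse (1 + \<xi>\<^sup>2)) = pi"
    using integrable_inverse_1_plus_square LBINT_inverse_1_plus_square
    by (simp_all add: set_integrable_def interval_lebesgue_integral_def set_lebesgue_integral_def)
  have pw: "cmod (F \<xi>) \<le> (inverse (1 + \<xi>\<^sup>2) + ?w \<xi>) / 2" for \<xi>
  proof -
    define p a where "p = 1 + \<xi>\<^sup>2" and "a = cmod (F \<xi>)"
    have p: "1 \<le> p" by (simp add: p_def)
    have "0 \<le> (inverse p - a)\<^sup>2 * p" using p by simp
    also have "\<dots> = inverse p - 2 * a + p * a\<^sup>2" using p by (simp add: field_simps power2_eq_square)
    finally have "2 * a \<le> inverse p + p * a\<^sup>2" by simp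
    moreover have "p * a\<^sup>2 \<le> p powr s * a\<^sup>2"
      using powr_mono[OF s p] p by (intro mult_right_mono) auto
    ultimately show ?thesis by (simp add: p_def a_def)
  qed
  have R: "integrable lborel (\<lambda>\<xi>. (inverse (1 + \<xi>\<^sup>2) + ?w \<xi>) / 2)" using c w by auto
  have F1: "integrable lborel F"
  proof (rule Bochner_Integration.integrable_bound[OF R])
    show "AE \<xi> in lborel. norm (F \<xi>) \<le> norm ((inverse (1 + \<xi>\<^sup>2) + ?w \<xi>) / 2)"
      using pw order_trans[OF pw abs_ge_self] by (intro AE_I2) (simp del: abs_divide)
  qed measurable
  have "(LINT \<xi>|lborel. cmod (F \<xi>)) \<le> (LINT \<xi>|lborel. (inverse (1 + \<xi>\<^sup>2) + ?w \<xi>) / 2)"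
    by (intro integral_mono integrable_norm F1 R pw)
  also have "\<dots> = (pi + (LINT \<xi>|lborel. ?w \<xi>)) / 2"
    using c w cpi by simp
  also have "\<dots> \<le> (pi + 1) / 2" using w1 by simp
  finally have "(LINT \<xi>|lborel. cmod (F \<xi>)) / sqrt (2 * pi) \<le> (pi + 1) / 2 / sqrt (2 * pi)"
    by (intro divide_right_mono) auto
  then show ?thesis
    using continuous_bounded_le_L1_fourier[OF F F1 cont bdd, of x] by simp
qed

section \<open>A comparison principle for transport inequalities\<close>

lemma DERIV_sqrt_one_plus_square:
  "((\<lambda>z::real. sqrt (1 + z\<^sup>2)) has_real_derivative y / sqrt (1 + y\<^sup>2)) (at y)"
proof -
  have "1 + y\<^sup>2 > 0" by (smt (verit) zero_le_power2)
  moreover have "((\<lambda>z::real. 1 + z\<^sup>2) has_real_derivative 2 * y) (at y)"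
    by (auto intro!: derivative_eq_intros)
  ultimately have "((\<lambda>z::real. sqrt (1 + z\<^sup>2)) has_real_derivative
      inverse (sqrt (1 + y\<^sup>2)) / 2 * (2 * y)) (at y)"
    by (intro DERIV_chain2[OF DERIV_real_sqrt, where g="\<lambda>z. 1 + z\<^sup>2"])
  then show ?thesis by (simp add: field_simps)
qed

text \<open>A maximum principle on an unbounded strip. Subtracting \<open>A t + \<eta> sqrt (1 + x\<^sup>2)\<close> forces a positive
  value of the difference to be attained as a maximum over a compact rectangle, away from its
  bottom and its lateral sides. There the \<open>x\<close>-derivative of \<open>v\<close> equals that of the barrier, so its
  modulus is at most \<open>\<eta>\<close>, and the inequality gives \<open>v\<^sub>t \<le> B + C \<eta> < A\<close>: the difference was larger just before.
  Letting \<open>\<eta> \<rightarrow> 0\<close> removes the barrier. Boundedness of \<open>v\<close> and of the speed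
  \<open>c\<close> is what controls spatial infinity, at all times at once.\<close>

lemma transport_upper_bound:
  fixes v vt vx c :: "real \<Rightarrow> real \<Rightarrow> real"
  assumes cont: "continuous_on ({0..d} \<times> UNIV) (\<lambda>(t, x). v t x)"
    and vt: "\<And>t x. 0 < t \<Longrightarrow> t \<le> d \<Longrightarrow> ((\<lambda>\<tau>. v \<tau> x) has_real_derivative vt t x) (at t)"
    and vx: "\<And>t x. 0 < t \<Longrightarrow> t \<le> d \<Longrightarrow> ((\<lambda>y. v t y) has_real_derivative vx t x) (at x)"
    and eq: "\<And>t x. 0 < t \<Longrightarrow> t \<le> d \<Longrightarrow> vt t x - c t x * vx t x \<le> B"
    and c: "\<And>t x. 0 < t \<Longrightarrow> t \<le> d \<Longrightarrow> \<bar>c t x\<bar> \<le> C"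
    and bdd: "\<And>t x. 0 \<le> t \<Longrightarrow> t \<le> d \<Longrightarrow> v t x \<le> M"
    and init: "\<And>x. v 0 x \<le> 0"
    and B: "0 \<le> B" and C: "0 \<le> C" and t: "0 \<le> t" "t \<le> d"
  shows "v t x \<le> B * t"
proof -
  have barrier: "v t x \<le> (B + C * \<eta> + \<eta>) * t + \<eta> * sqrt (1 + x\<^sup>2)" if \<eta>: "\<eta> > 0" for \<eta>
  proof (rule ccontr)
    define A where "A = B + C * \<eta> + \<eta>"
    define w where "w = (\<lambda>t x. v t x - A * t - \<eta> * sqrt (1 + x\<^sup>2))"
    assume "\<not> ?thesis"
    then have pos: "w t x > 0" by (simp add: w_def A_def)
    have A: "A \<ge> 0" using B C \<eta> by (simp add: A_def)
    \<comment> \<open>At distance \<open>N\<close> the barrier exceeds the bound \<open>M\<close>, and the rectangle still contains the point \<open>x\<close>.\<close>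
    define N where "N = \<bar>x\<bar> + \<bar>M\<bar> / \<eta> + 1"
    have "continuous_on ({0..d} \<times> UNIV) (\<lambda>p. case p of (t, x) \<Rightarrow> v t x)" by (rule cont)
    then have "continuous_on ({0..d} \<times> {-N..N}) (\<lambda>p. v (fst p) (snd p))"
      by (rule continuous_on_subset[THEN continuous_on_cong[THEN iffD1, rotated -1]])
         (auto simp: case_prod_unfold)
    then have wc: "continuous_on ({0..d} \<times> {-N..N}) (\<lambda>p. w (fst p) (snd p))"
      unfolding w_def by (intro continuous_intros)
    have mem: "(t, x) \<in> {0..d} \<times> {-N..N}"
    proof -
      have "\<bar>M\<bar> / \<eta> \<ge> 0" using \<eta> by simp
      then show ?thesis using t by (auto simp: N_def)
    qed
    obtain p where p: "p \<in> {0..d} \<times> {-N..N}"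
      and pmax: "\<And>q. q \<in> {0..d} \<times> {-N..N} \<Longrightarrow> w (fst q) (snd q) \<le> w (fst p) (snd p)"
      using continuous_attains_sup[OF _ _ wc] mem by (auto simp: compact_Times)
    define a y where "a = fst p" and "y = snd p"
    have ay: "0 \<le> a" "a \<le> d" "-N \<le> y" "y \<le> N"
      using p by (auto simp: a_def y_def)
    have max: "w \<tau> z \<le> w a y" if "0 \<le> \<tau>" "\<tau> \<le> d" "-N \<le> z" "z \<le> N" for \<tau> z
      using pmax[of "(\<tau>, z)"] that by (auto simp: a_def y_def)
    have wpos: "w a y > 0" using pos max[of t x] mem by auto
    have "a \<noteq> 0"
    proof
      assume "a = 0"
      then have "w a y \<le> - \<eta> * sqrt (1 + y\<^sup>2)" using init[of y] by (simp add: w_def)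
      also have "\<dots> \<le> 0" using \<eta> by simp
      finally show False using wpos by simp
    qed
    then have a0: "a > 0" using ay by simp
    have yN: "\<bar>y\<bar> < N"
    proof (rule ccontr)
      assume "\<not> ?thesis"
      then have "\<bar>y\<bar> = N" using ay by auto
      then have "N \<le> sqrt (1 + y\<^sup>2)" by (metis real_sqrt_abs real_sqrt_le_mono le_add_same_cancel2 zero_le_one)
      then have "\<eta> * N \<le> \<eta> * sqrt (1 + y\<^sup>2)" using \<eta> by simp
      moreover have "\<eta> * N > M"
      proof -
        have "\<eta> * N = \<eta> * (\<bar>x\<bar> + 1) + \<bar>M\<bar>" using \<eta> by (simp add: N_def field_simps)
        moreover have "\<eta> * (\<bar>x\<bar> + 1) > 0" using \<eta> by (intro mult_pos_pos) auto
        ultimately show ?thesis by linarith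
      qed
      moreover have "A * a \<ge> 0" using A ay by simp
      moreover have "v a y \<le> M" using bdd ay by simp
      ultimately have "w a y < 0" unfolding w_def by linarith
      then show False using wpos by simp
    qed
    have sq: "1 + y\<^sup>2 > 0" by (smt (verit) zero_le_power2)
    have dwx: "((\<lambda>z. w a z) has_real_derivative (vx a y - \<eta> * (y / sqrt (1 + y\<^sup>2)))) (at y)"
    proof -
      have "((\<lambda>z. sqrt (1 + z\<^sup>2)) has_real_derivative y / sqrt (1 + y\<^sup>2)) (at y)"
        by (rule DERIV_sqrt_one_plus_square)
      from DERIV_diff[OF DERIV_diff[OF vx[OF a0 \<open>a \<le> d\<close>] DERIV_const] DERIV_cmult[OF this]]
      show ?thesis by (simp add: w_def)
    qed
    have "vx a y - \<eta> * (y / sqrt (1 + y\<^sup>2)) = 0"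
    proof (rule DERIV_local_max[OF dwx])
      show "0 < N - \<bar>y\<bar>" using yN by simp
      show "\<forall>z. \<bar>y - z\<bar> < N - \<bar>y\<bar> \<longrightarrow> w a z \<le> w a y"
        using max ay by (auto simp: abs_if split: if_splits)
    qed
    then have "vx a y = \<eta> * (y / sqrt (1 + y\<^sup>2))" by simp
    moreover have "\<bar>y / sqrt (1 + y\<^sup>2)\<bar> \<le> 1"
    proof -
      have "\<bar>y\<bar> \<le> sqrt (1 + y\<^sup>2)"
        by (metis real_sqrt_abs real_sqrt_le_mono le_add_same_cancel2 zero_le_one)
      then show ?thesis using sq by (simp add: divide_le_eq_1)
    qed
    ultimately have "\<bar>vx a y\<bar> \<le> \<eta> * 1"
      unfolding abs_mult using \<eta> by (metis abs_mult abs_of_pos mult_left_mono less_imp_le)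
    then have "\<bar>vx a y\<bar> \<le> \<eta>" by simp
    then have "\<bar>c a y * vx a y\<bar> \<le> C * \<eta>"
      unfolding abs_mult using c[of a y] a0 ay by (intro mult_mono) auto
    then have neg: "vt a y - A < 0" using eq[of a y] a0 ay \<eta> by (auto simp: A_def)
    have dwt: "((\<lambda>\<tau>. w \<tau> y) has_real_derivative (vt a y - A)) (at a)"
      unfolding w_def using ay a0 by (auto intro!: derivative_eq_intros vt)
    \<comment> \<open>The maximum may lie on the top side, so only times before it are compared.\<close>
    from DERIV_neg_dec_left[OF dwt neg] obtain h where h: "h > 0"
      "\<And>k. 0 < k \<Longrightarrow> k < h \<Longrightarrow> w a y < w (a - k) y" by auto
    define k where "k = min (h / 2) a"
    have "0 < k" "k < h" "k \<le> a" using h a0 by (auto simp: k_def)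
    then have "w a y < w (a - k) y" "w (a - k) y \<le> w a y" using h(2)[of k] max[of "a - k" y] ay by auto
    then show False by simp
  qed
  have "((\<lambda>\<eta>. (B + C * \<eta> + \<eta>) * t + \<eta> * sqrt (1 + x\<^sup>2)) \<longlongrightarrow> (B + C * 0 + 0) * t + 0 * sqrt (1 + x\<^sup>2)) (at_right 0)"
    by (intro tendsto_intros)
  then have "v t x \<le> (B + C * 0 + 0) * t + 0 * sqrt (1 + x\<^sup>2)"
    by (rule tendsto_lowerbound) (auto simp: eventually_at_filter barrier)
  then show ?thesis by simp
qed

section \<open>The nonlocal term\<close>

lemma G_nonneg: "0 \<le> G z"
  by (simp add: G_def g_def sgn_if)

lemma G_pos: "z < 0 \<Longrightarrow> 0 < G z"
  by (simp add: G_def g_def)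

text \<open>Up to the value at one point, \<open>G (x - y)\<close> is the exponential density on the half-line \<open>y > x\<close>.\<close>

lemma
  shows integrable_G: "integrable lborel (\<lambda>y. G (x - y))"
    and integral_G: "(LINT y|lborel. G (x - y)) = 1"
proof -
  let ?h = "\<lambda>y::real. indicator {0<..} y *\<^sub>R exp (- y) :: real"
  have h: "integrable lborel ?h"
    using integrable_I0i_exp_mscale[of 1] by (simp add: set_integrable_def)
  have hI: "integral\<^sup>L lborel ?h = 1"
    using LBINT_I0i_exp_mscale[of 1] by (simp add: interval_lebesgue_integral_def set_lebesgue_integral_def
        einterval_def greaterThan_def)
  have ae: "AE y in lborel. ?h (-x + 1 * y) = G (x - y)"
    using AE_lborel_singleton[of x]
    by eventually_elim (auto simp: G_def g_def sgn_if split: split_indicator)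
  have m: "(\<lambda>y. G (x - y)) \<in> borel_measurable lborel"
    unfolding G_def g_def sgn_if by measurable
  have "integrable lborel (\<lambda>y. ?h (-x + 1 * y))"
    using h by (rule lborel_integrable_real_affine) simp
  then show "integrable lborel (\<lambda>y. G (x - y))"
    by (subst (asm) integrable_cong_AE[OF _ m ae]) auto
  have "(LINT y|lborel. G (x - y)) = (LINT y|lborel. ?h (-x + 1 * y))"
    by (intro integral_cong_AE m) (use ae in auto)
  also have "\<dots> = 1"
    using lborel_integral_real_affine[of 1 ?h "-x"] hI by simp
  finally show "(LINT y|lborel. G (x - y)) = 1" .
qed

lemma nonlocal_term_bounds:
  assumes int: "integrable lborel (\<lambda>y. G (x - y) * (f y)\<^sup>2)" and K: "\<And>y. \<bar>f y\<bar> \<le> K"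
  shows "0 \<le> (LINT y|lborel. G (x - y) * (f y)\<^sup>2)"
    and "(LINT y|lborel. G (x - y) * (f y)\<^sup>2) \<le> K\<^sup>2"
proof -
  show "0 \<le> (LINT y|lborel. G (x - y) * (f y)\<^sup>2)"
    by (intro Bochner_Integration.integral_nonneg) (simp add: G_nonneg)
  have "(f y)\<^sup>2 \<le> K\<^sup>2" for y using power_mono[OF K[of y], of 2] by simp
  then have "(LINT y|lborel. G (x - y) * (f y)\<^sup>2) \<le> (LINT y|lborel. G (x - y) * K\<^sup>2)"
    by (intro integral_mono int integrable_mult_left integrable_G mult_left_mono) (auto simp: G_nonneg)
  then show "(LINT y|lborel. G (x - y) * (f y)\<^sup>2) \<le> K\<^sup>2"
    by (simp add: integral_G integrable_G)
qed

text \<open>The integrand is nonnegative, so it vanishes almost everywhere; the kernel is positive on \<open>y > x\<close>,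
  and continuity of \<open>f\<close> turns almost everywhere into everywhere.\<close>

lemma vanishing_right_of_nonlocal_zero:
  assumes int: "integrable lborel (\<lambda>y. G (x - y) * (f y)\<^sup>2)"
    and zero: "(LINT y|lborel. G (x - y) * (f y)\<^sup>2) = 0"
    and cont: "continuous_on UNIV f" and xy: "x < y"
  shows "f y = 0"
proof -
  have "AE y in lborel. G (x - y) * (f y)\<^sup>2 = 0"
    using integral_nonneg_eq_0_iff_AE[OF int] zero by (simp add: G_nonneg)
  then have "AE y in lborel. y \<in> {x<..} \<longrightarrow> y \<in> {y. f y = 0}"
  proof eventually_elim
    case (elim y)
    then show ?case using G_pos[of "x - y"] by auto
  qed
  then have "AE y in lebesgue. y \<in> {x<..} \<longrightarrow> y \<in> {y. f y = 0}"
    by (rule AE_completion)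
  then show ?thesis
    using mem_closed_if_AE_lebesgue_open[of "{x<..}" "{y. f y = 0}" y] xy
      closed_Collect_eq[OF cont continuous_on_const] by auto
qed

lemma smooth_on_slices:
  assumes "smooth_on S u" and "(t, x) \<in> S"
  shows "(\<lambda>\<tau>. u \<tau> x) differentiable (at t)" and "u t differentiable (at x)"
proof -
  have "Ck_on (Suc 0) S u" using assms(1) unfolding smooth_on_def by blast
  then show "(\<lambda>\<tau>. u \<tau> x) differentiable (at t)" "u t differentiable (at x)"
    using assms(2) by auto
qed

text \<open>The step in which the vanishing spreads from the half-line to the whole line. The nonlocal equation
  is evaluated at a point \<open>x\<close> of the open set that also lies to the left of \<open>y\<close>.\<close>

lemma vanishing_time_slice:
  assumes smooth: "smooth_on ({0<..<T} \<times> UNIV) u" and nonlocal: "solves_nonlocal T u"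
    and t: "t \<in> {T0<..<T1}" "t \<in> {0<..<T}"
    and zero: "\<And>t x. t \<in> {T0<..<T1} \<Longrightarrow> x < b \<Longrightarrow> u t x = 0"
  shows "u t y = 0"
proof -
  define x where "x = min b y - 1"
  have x: "x < b" "x < y" by (auto simp: x_def)
  have "\<forall>\<^sub>F \<tau> in nhds t. \<tau> \<in> {T0<..<T1}"
    using t(1) by (intro eventually_nhds_in_open) auto
  then have "\<forall>\<^sub>F \<tau> in nhds t. u \<tau> x = 0"
    by eventually_elim (use zero x in auto)
  then have "dt u t x = 0"
    unfolding dt_def using deriv_cong_ev[of "\<lambda>\<tau>. u \<tau> x" "\<lambda>_. 0" t t] by simp
  moreover have "u t x = 0" using zero t x by simp
  moreover have "integrable lborel (\<lambda>z. G (x - z) * (u t z)\<^sup>2)"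
    and "dt u t x + (u t x)\<^sup>2 - 2 * u t x * dx u t x = (LINT z|lborel. G (x - z) * (u t z)\<^sup>2)"
    using nonlocal t by (auto simp: solves_nonlocal_def)
  moreover have "continuous_on UNIV (u t)"
    using smooth_on_slices(2)[OF smooth] t
    by (intro differentiable_imp_continuous_on differentiable_at_imp_differentiable_on) auto
  ultimately show ?thesis
    using vanishing_right_of_nonlocal_zero[of x "u t" y] x by simp
qed

section \<open>Local uniqueness of the zero solution\<close>

text \<open>The comparison principle is applied to the four functions \<open>\<plusminus> u (t\<^sub>0 \<plusminus> \<tau>)\<close>: the sign \<open>\<rho>\<close> yields the lower
  bound as well as the upper one, and the sign \<open>\<sigma>\<close> the past as well as the future. All of them
  satisfy a transport inequality with source \<open>K\<^sup>2\<close>, because \<open>u\<^sup>2\<close> and \<open>G \<ast> u\<^sup>2\<close> both lie in \<open>[0, K\<^sup>2]\<close>.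
  Reversing time changes only the sign of the speed and of the source, which is why uniqueness
  holds in both directions.\<close>

lemma sup_norm_halving:
  assumes smooth: "smooth_on ({0<..<T} \<times> UNIV) u" and nonlocal: "solves_nonlocal T u"
    and strip: "{t0 - \<delta>..t0 + \<delta>} \<subseteq> {0<..<T}" and init: "\<And>x. u t0 x = 0"
    and K: "\<And>t x. \<bar>t - t0\<bar> \<le> \<delta> \<Longrightarrow> \<bar>u t x\<bar> \<le> K" and small: "2 * \<delta> * K \<le> 1"
    and t: "\<bar>t - t0\<bar> \<le> \<delta>"
  shows "\<bar>u t x\<bar> \<le> K / 2"
proof -
  have sm: "Ck_on (Suc 0) ({0<..<T} \<times> UNIV) u"
    using smooth unfolding smooth_on_def by blast
  have cont: "continuous_on ({0<..<T} \<times> UNIV) (\<lambda>(t, x). u t x)" using sm by simp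
  have inT: "\<tau> \<in> {0<..<T}" if "\<bar>\<tau> - t0\<bar> \<le> \<delta>" for \<tau>
    using strip that by (auto simp: subset_iff abs_le_iff)
  have ut: "((\<lambda>\<tau>. u \<tau> x) has_real_derivative dt u \<tau> x) (at \<tau>)"
    and ux: "((\<lambda>y. u \<tau> y) has_real_derivative dx u \<tau> x) (at x)"
    if "\<bar>\<tau> - t0\<bar> \<le> \<delta>" for \<tau> x
    using sm inT[OF that] by (auto simp: dt_def dx_def DERIV_deriv_iff_real_differentiable)
  have rhs: "\<bar>dt u \<tau> y - 2 * u \<tau> y * dx u \<tau> y\<bar> \<le> K\<^sup>2" if "\<bar>\<tau> - t0\<bar> \<le> \<delta>" for \<tau> y
  proof -
    have "integrable lborel (\<lambda>z. G (y - z) * (u \<tau> z)\<^sup>2)"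
      and e: "dt u \<tau> y + (u \<tau> y)\<^sup>2 - 2 * u \<tau> y * dx u \<tau> y = (LINT z|lborel. G (y - z) * (u \<tau> z)\<^sup>2)"
      using nonlocal inT[OF that] by (auto simp: solves_nonlocal_def)
    note b = nonlocal_term_bounds[OF this(1) K[OF that]]
    have "(u \<tau> y)\<^sup>2 \<le> K\<^sup>2" using power_mono[OF K[OF that, of y], of 2] by simp
    moreover have "0 \<le> (u \<tau> y)\<^sup>2" by simp
    ultimately show ?thesis using b e by linarith
  qed
  have d0: "0 \<le> \<delta>" using t by simp
  have K0: "0 \<le> K" using K[of t0 0] d0 by simp
  have one_sided: "\<rho> * u (t0 + \<sigma> * \<tau>) y \<le> K\<^sup>2 * \<tau>"
    if \<rho>: "\<bar>\<rho>\<bar> = 1" and \<sigma>: "\<bar>\<sigma>\<bar> = 1" and \<tau>: "0 \<le> \<tau>" "\<tau> \<le> \<delta>" for \<rho> \<sigma> \<tau> y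
  proof (rule transport_upper_bound[where v="\<lambda>\<tau> y. \<rho> * u (t0 + \<sigma> * \<tau>) y" and d=\<delta> and C="2 * K" and M=K
        and vt="\<lambda>\<tau> y. \<rho> * (\<sigma> * dt u (t0 + \<sigma> * \<tau>) y)" and vx="\<lambda>\<tau> y. \<rho> * dx u (t0 + \<sigma> * \<tau>) y"
        and c="\<lambda>\<tau> y. 2 * \<sigma> * u (t0 + \<sigma> * \<tau>) y"])
    have near: "\<bar>t0 + \<sigma> * \<tau> - t0\<bar> \<le> \<delta>" if "0 \<le> \<tau>" "\<tau> \<le> \<delta>" for \<tau>
      using that \<sigma> by (simp add: abs_mult)
    have "continuous_on ({0..\<delta>} \<times> UNIV) ((\<lambda>(t, x). u t x) \<circ> (\<lambda>p. (t0 + \<sigma> * fst p, snd p)))"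
    proof (rule continuous_on_compose)
      show "continuous_on ({0..\<delta>} \<times> UNIV) (\<lambda>p::real \<times> real. (t0 + \<sigma> * fst p, snd p))"
        by (intro continuous_intros)
      show "continuous_on ((\<lambda>p. (t0 + \<sigma> * fst p, snd p)) ` ({0..\<delta>} \<times> UNIV)) (\<lambda>(t, x). u t x)"
        by (rule continuous_on_subset[OF cont]) (use near inT in auto)
    qed
    then show "continuous_on ({0..\<delta>} \<times> UNIV) (\<lambda>(\<tau>, y). \<rho> * u (t0 + \<sigma> * \<tau>) y)"
      by (auto simp: case_prod_unfold o_def intro!: continuous_intros)
    fix \<tau> y
    assume p: "0 < \<tau>" "\<tau> \<le> \<delta>"
    have n: "\<bar>t0 + \<sigma> * \<tau> - t0\<bar> \<le> \<delta>" using near p by simp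
    have "((\<lambda>\<tau>. t0 + \<sigma> * \<tau>) has_real_derivative \<sigma>) (at \<tau>)"
      by (auto intro!: derivative_eq_intros)
    from DERIV_chain2[OF ut[OF n] this]
    show "((\<lambda>\<tau>. \<rho> * u (t0 + \<sigma> * \<tau>) y) has_real_derivative \<rho> * (\<sigma> * dt u (t0 + \<sigma> * \<tau>) y)) (at \<tau>)"
      by (intro DERIV_cmult) (simp add: mult.commute)
    show "((\<lambda>y. \<rho> * u (t0 + \<sigma> * \<tau>) y) has_real_derivative \<rho> * dx u (t0 + \<sigma> * \<tau>) y) (at y)"
      by (intro DERIV_cmult ux n)
    have "\<bar>\<rho> * \<sigma> * (dt u (t0 + \<sigma> * \<tau>) y - 2 * u (t0 + \<sigma> * \<tau>) y * dx u (t0 + \<sigma> * \<tau>) y)\<bar> \<le> K\<^sup>2"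
      using rhs[OF n, of y] \<rho> \<sigma> by (simp add: abs_mult)
    then show "\<rho> * (\<sigma> * dt u (t0 + \<sigma> * \<tau>) y)
        - 2 * \<sigma> * u (t0 + \<sigma> * \<tau>) y * (\<rho> * dx u (t0 + \<sigma> * \<tau>) y) \<le> K\<^sup>2"
      by (simp add: algebra_simps abs_le_iff)
    show "\<bar>2 * \<sigma> * u (t0 + \<sigma> * \<tau>) y\<bar> \<le> 2 * K"
      using K[OF n, of y] \<sigma> by (simp add: abs_mult)
  next
    fix \<tau> y assume p: "0 \<le> \<tau>" "\<tau> \<le> \<delta>"
    have "\<bar>t0 + \<sigma> * \<tau> - t0\<bar> \<le> \<delta>" using p \<sigma> by (simp add: abs_mult)
    from K[OF this, of y] have "\<bar>\<rho> * u (t0 + \<sigma> * \<tau>) y\<bar> \<le> K" using \<rho> by (simp add: abs_mult)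
    then show "\<rho> * u (t0 + \<sigma> * \<tau>) y \<le> K" by linarith
  qed (use \<tau> K0 init in auto)
  define \<sigma> :: real where "\<sigma> = (if t0 \<le> t then 1 else -1)"
  have \<sigma>: "\<bar>\<sigma>\<bar> = 1" "t0 + \<sigma> * \<bar>t - t0\<bar> = t" by (auto simp: \<sigma>_def)
  have "\<bar>u t x\<bar> \<le> K\<^sup>2 * \<bar>t - t0\<bar>"
    using one_sided[of 1 \<sigma> "\<bar>t - t0\<bar>" x] one_sided[of "-1" \<sigma> "\<bar>t - t0\<bar>" x] \<sigma> t by auto
  also have "\<dots> \<le> K\<^sup>2 * \<delta>" using t by (intro mult_left_mono) auto
  also have "\<dots> = K * (2 * \<delta> * K) / 2" by (simp add: power2_eq_square)
  also have "\<dots> \<le> K * 1 / 2" using small K0 by (intro divide_right_mono mult_left_mono) auto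
  finally show ?thesis by simp
qed

text \<open>On a fixed time interval of length at most about \<open>1 / M\<close>, every bound for \<open>\<bar>u\<bar>\<close> that does not exceed \<open>M\<close>
  can be halved, and so on indefinitely.\<close>

lemma local_uniqueness_at_zero:
  assumes smooth: "smooth_on ({0<..<T} \<times> UNIV) u" and nonlocal: "solves_nonlocal T u"
    and t0: "t0 \<in> {0<..<T}" and init: "\<And>x. u t0 x = 0"
    and r: "r > 0" and M: "\<And>t x. t \<in> {0<..<T} \<Longrightarrow> \<bar>t - t0\<bar> < r \<Longrightarrow> \<bar>u t x\<bar> \<le> M"
  shows "\<exists>\<delta>>0. \<forall>t x. \<bar>t - t0\<bar> \<le> \<delta> \<longrightarrow> u t x = 0"
proof -
  have M0: "0 \<le> M" using M[OF t0] r by (smt (verit))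
  \<comment> \<open>The last entry is the smallness that halving needs; it has \<open>2 M + 1\<close> in place of \<open>2 M\<close>
    because \<open>M\<close> may be \<open>0\<close>.\<close>
  define \<delta> where "\<delta> = Min {r / 2, t0 / 2, (T - t0) / 2, 1 / (2 * M + 1)}"
  have d: "\<delta> > 0" using r t0 M0 by (auto simp: \<delta>_def)
  have le: "\<delta> \<le> r / 2" "\<delta> \<le> t0 / 2" "\<delta> \<le> (T - t0) / 2" "\<delta> \<le> 1 / (2 * M + 1)"
    unfolding \<delta>_def by (rule Min_le; simp)+
  have strip: "{t0 - \<delta>..t0 + \<delta>} \<subseteq> {0<..<T}"
  proof
    fix t assume "t \<in> {t0 - \<delta>..t0 + \<delta>}"
    then have "t0 - \<delta> \<le> t" "t \<le> t0 + \<delta>" by auto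
    moreover have "t0 / 2 < t0" "(T - t0) / 2 < T - t0" using t0 by auto
    ultimately show "t \<in> {0<..<T}" using le by simp
  qed
  have small: "2 * \<delta> * M \<le> 1"
  proof -
    have "2 * \<delta> * M \<le> 2 * (1 / (2 * M + 1)) * M" using le M0 by (intro mult_right_mono) auto
    also have "\<dots> \<le> 1" using M0 by (simp add: field_simps)
    finally show ?thesis .
  qed
  have geo: "\<bar>u t x\<bar> \<le> M * (1/2)^n" if "\<bar>t - t0\<bar> \<le> \<delta>" for n t x
    using that
  proof (induction n arbitrary: t x)
    case 0
    then have "t \<in> {0<..<T}" using strip by (auto simp: subset_iff abs_le_iff)
    then show ?case using M[of t x] 0 le r by auto
  next
    case (Suc n)
    have "2 * \<delta> * (M * (1/2)^n) \<le> 2 * \<delta> * (M * 1)"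
      using d M0 by (intro mult_left_mono) (auto simp: power_le_one)
    then have "2 * \<delta> * (M * (1/2)^n) \<le> 1" using small by simp
    from sup_norm_halving[OF smooth nonlocal strip init Suc.IH this Suc.prems]
    show ?case by simp
  qed
  have "u t x = 0" if "\<bar>t - t0\<bar> \<le> \<delta>" for t x
  proof -
    have "(\<lambda>n. M * (1/2)^n) \<longlonglongrightarrow> M * 0" by (intro tendsto_intros) auto
    then have "\<bar>u t x\<bar> \<le> M * 0"
      by (rule Lim_bounded2[where N=0 and C="\<bar>u t x\<bar>"]) (use geo[OF that] in auto)
    then show ?thesis by simp
  qed
  then show ?thesis using d by blast
qed

lemma bounded_of_decaying:
  fixes f :: "real \<Rightarrow> real"
  assumes cont: "continuous_on UNIV f" and lim: "(f \<longlongrightarrow> 0) at_infinity"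
  obtains B where "\<And>y. \<bar>f y\<bar> \<le> B"
proof -
  have "\<forall>\<^sub>F y in at_infinity. \<bar>f y\<bar> < 1"
    using tendstoD[OF lim, of 1] by (simp add: dist_real_def)
  then obtain N where N: "\<And>y. N \<le> norm y \<Longrightarrow> \<bar>f y\<bar> < 1"
    unfolding eventually_at_infinity by blast
  have "bounded (f ` cball 0 N)"
    by (intro compact_imp_bounded compact_continuous_image continuous_on_subset[OF cont]) auto
  then obtain B where B: "\<And>y. y \<in> cball 0 N \<Longrightarrow> \<bar>f y\<bar> \<le> B"
    unfolding bounded_iff by (metis imageI real_norm_def)
  show thesis
  proof
    fix y show "\<bar>f y\<bar> \<le> max B 1" using N[of y] B[of y] by (cases "N \<le> norm y") auto
  qed
qed

text \<open>The uniform bound from which the halving starts. As \<open>u t\<^sub>0 = 0\<close>, continuity in \<open>H\<^sup>s\<close> at \<open>t\<^sub>0\<close> says that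
  the \<open>H\<^sup>s\<close> norm of \<open>u t\<close> itself is below \<open>1\<close> near \<open>t\<^sub>0\<close>.\<close>

lemma sup_norm_bound_near_zero:
  assumes s: "1 \<le> s" and smooth: "smooth_on ({0<..<T} \<times> UNIV) u"
    and decay: "decaying_on {0<..<T} u" and C0: "C0_Hs {0<..<T} s u"
    and t0: "t0 \<in> {0<..<T}" and init: "\<And>x. u t0 x = 0"
  shows "\<exists>r>0. \<forall>t\<in>{0<..<T}. \<bar>t - t0\<bar> < r \<longrightarrow> (\<forall>x. \<bar>u t x\<bar> \<le> (pi + 1) / (2 * sqrt (2 * pi)))"
proof -
  let ?f = "\<lambda>t x. complex_of_real (u t x)"
  have "((\<lambda>\<tau>. Hs_norm s (?f \<tau>)) \<longlongrightarrow> 0) (at t0 within {0<..<T})"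
  proof -
    have "((\<lambda>\<tau>. Hs_norm s (\<lambda>x. complex_of_real (u \<tau> x - u t0 x))) \<longlongrightarrow> 0) (at t0 within {0<..<T})"
      using C0 t0 unfolding C0_Hs_def by blast
    then show ?thesis by (simp add: init)
  qed
  then have "\<forall>\<^sub>F \<tau> in at t0 within {0<..<T}. Hs_norm s (?f \<tau>) < 1"
    by (rule order_tendstoD) simp
  then obtain r where r: "r > 0" and
    small: "\<And>t. t \<in> {0<..<T} \<Longrightarrow> t \<noteq> t0 \<Longrightarrow> dist t t0 < r \<Longrightarrow> Hs_norm s (?f t) < 1"
    unfolding eventually_at by auto
  have "\<bar>u t x\<bar> \<le> (pi + 1) / (2 * sqrt (2 * pi))" if t: "t \<in> {0<..<T}" "\<bar>t - t0\<bar> < r" for t x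
  proof (cases "t = t0")
    case True
    then show ?thesis by (simp add: init)
  next
    case False
    have cont: "continuous_on UNIV (u t)"
      using smooth_on_slices(2)[OF smooth] t
      by (intro differentiable_imp_continuous_on differentiable_at_imp_differentiable_on) auto
    have "((\<lambda>x. u t x) \<longlongrightarrow> 0) at_infinity"
      using decay t(1) by (auto simp: decaying_on_def dest!: bspec spec[where x=0])
    then obtain B where "\<And>y. \<bar>u t y\<bar> \<le> B"
      using bounded_of_decaying[OF cont] by blast
    then have "cmod (?f t x) \<le> (pi + 1) / (2 * sqrt (2 * pi))"
      using C0 t small[OF t(1) False] cont
      by (intro sup_bound_of_Hs_norm[OF s, where B=B])
         (auto simp: C0_Hs_def dist_real_def intro!: continuous_intros)
    then show ?thesis by simp
  qed
  then show ?thesis using r by blast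
qed

section \<open>Unique continuation\<close>

theorem theorem4p4:
  "\<exists>s0::real. \<forall>s\<ge>s0. \<forall>(T::real) (u :: real \<Rightarrow> real \<Rightarrow> real) (T0::real) (T1::real) (b::real).
     T > 0 \<longrightarrow>
     smooth_on ({0<..<T} \<times> UNIV) u \<longrightarrow>
     decaying_on {0<..<T} u \<longrightarrow>
     C0_Hs {0<..<T} s u \<longrightarrow>
     solves_pde T u \<longrightarrow>
     solves_nonlocal T u \<longrightarrow>
     {T0<..<T1} \<times> {..<b} \<noteq> {} \<longrightarrow>
     {T0<..<T1} \<times> {..<b} \<subseteq> {0<..<T} \<times> (UNIV :: real set) \<longrightarrow>
     (\<forall>(t, x) \<in> {T0<..<T1} \<times> {..<b}. u t x = 0) \<longrightarrow>
     (\<forall>t\<in>{0<..<T}. \<forall>x. u t x = 0)"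
proof (intro exI[of _ 1] allI impI)
  fix s T T0 T1 b :: real and u :: "real \<Rightarrow> real \<Rightarrow> real"
  assume s: "1 \<le> s" and smooth: "smooth_on ({0<..<T} \<times> UNIV) u"
    and decay: "decaying_on {0<..<T} u" and C0: "C0_Hs {0<..<T} s u"
    and nonlocal: "solves_nonlocal T u"
    and ne: "{T0<..<T1} \<times> {..<b} \<noteq> {}"
    and sub: "{T0<..<T1} \<times> {..<b} \<subseteq> {0<..<T} \<times> (UNIV :: real set)"
    and zero: "\<forall>(t, x) \<in> {T0<..<T1} \<times> {..<b}. u t x = 0"
  define Z where "Z = {t \<in> {0<..<T}. \<forall>x. u t x = 0}"
  obtain tm where tm: "tm \<in> {T0<..<T1}" using ne by blast
  have "tm \<in> {0<..<T}" using tm sub ne by blast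
  then have "tm \<in> Z"
    unfolding Z_def using vanishing_time_slice[OF smooth nonlocal, of tm T0 T1 b] zero tm by auto
  moreover have "open Z"
    unfolding open_dist
  proof
    fix t0 assume "t0 \<in> Z"
    then have t0: "t0 \<in> {0<..<T}" and init: "\<And>x. u t0 x = 0" by (auto simp: Z_def)
    obtain r where "r > 0" "\<forall>t\<in>{0<..<T}. \<bar>t - t0\<bar> < r \<longrightarrow> (\<forall>x. \<bar>u t x\<bar> \<le> (pi + 1) / (2 * sqrt (2 * pi)))"
      using sup_norm_bound_near_zero[OF s smooth decay C0 t0 init] by blast
    then obtain \<delta> where \<delta>: "\<delta> > 0" "\<forall>t x. \<bar>t - t0\<bar> \<le> \<delta> \<longrightarrow> u t x = 0"
      using local_uniqueness_at_zero[OF smooth nonlocal t0 init] by metis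
    obtain e where e: "e > 0" "\<And>t. dist t t0 < e \<Longrightarrow> t \<in> {0<..<T}"
      using open_greaterThanLessThan[of 0 T] t0 unfolding open_dist by metis
    show "\<exists>e>0. \<forall>t. dist t t0 < e \<longrightarrow> t \<in> Z"
      using \<delta> e by (intro exI[of _ "min \<delta> e"]) (auto simp: Z_def dist_real_def)
  qed
  moreover have "closedin (top_of_set {0<..<T}) Z"
  proof -
    have "Z = (\<Inter>x. {t \<in> {0<..<T}. u t x = 0})" by (auto simp: Z_def)
    moreover have "closedin (top_of_set {0<..<T}) {t \<in> {0<..<T}. u t x = 0}" for x
    proof -
      have "continuous_on {0<..<T} (\<lambda>t. u t x)"
        using smooth_on_slices(1)[OF smooth]
        by (intro differentiable_imp_continuous_on differentiable_at_imp_differentiable_on) auto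
      then show ?thesis by (rule continuous_closedin_preimage_constant)
    qed
    ultimately show ?thesis by (auto intro: closedin_INT)
  qed
  moreover have "Z \<subseteq> {0<..<T}" by (auto simp: Z_def)
  ultimately have "Z = {0<..<T}"
    using connected_clopen[of "{0<..<T}"] open_openin_trans[of "{0<..<T}" Z] by auto
  then show "\<forall>t\<in>{0<..<T}. \<forall>x. u t x = 0" by (auto simp: Z_def)
qed

end
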